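(* Let $K$ be a number field with ring of integers $\mathcal{O}_K$, and let $\phi(x) = x^d + a_{d-1} x^{d-1} + \dotsb + a_0\in \mathcal{O}_K[x]$ with $d\ge 2$. Assume that $0$ is preperiodic under $\phi$, and that for every archimedean place $\nu$ of $K$ the Julia set of $\phi$ (as a complex polynomial via the embedding corresponding to $\nu$) does not intersect the open unit disk $\{z\in\mathbb{C}:|z|<1\}$. Then $\phi(x)=x^d$.
   Context: A point $z$ is preperiodic under $\phi$ if $\phi^n(z)=\phi^m(z)$ for some $n>m\ge0$. The Julia set is the complement of the set where the iterates $\{\phi^n\}$ form an equicontinuous family (equivalently, the support of the canonical invariant measure). *)

theory Defs
  imports "HOL-Complex_Analysis.Complex_Analysis" "HOL-Computational_Algebra.Computational_Algebra"
begin

definition preperiodic :: "('a \<Rightarrow> 'a) \<Rightarrow> 'a \<Rightarrow> bool" where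
  "preperiodic f z \<longleftrightarrow> (\<exists>n m. n > m \<and> (f ^^ n) z = (f ^^ m) z)"


text \<open>
  A number field is a type of class \<^class>\<open>field_char_0\<close> that is finitely generated as a vector
  space over the rationals. Its ring of integers is the set of its elements satisfying
  \<^const>\<open>algebraic_int\<close>.
\<close>

definition number_field :: "'k :: field_char_0 itself \<Rightarrow> bool" where
  "number_field _ \<longleftrightarrow>
     (\<exists>B :: 'k set. finite B \<and> module.span (\<lambda>(q :: rat) x. of_rat q * x) B = UNIV)"

lemma vector_space_of_rat: "vector_space (\<lambda>(q :: rat) (x :: 'k :: field_char_0). of_rat q * x)"
  by unfold_locales (simp_all add: algebra_simps of_rat_add of_rat_mult)

definition ring_of_integers :: "'k :: field_char_0 set" where
  "ring_of_integers = {x. algebraic_int x}"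

definition field_embedding :: "('a :: field \<Rightarrow> 'b :: field) \<Rightarrow> bool" where
  "field_embedding \<sigma> \<longleftrightarrow> \<sigma> 1 = 1 \<and>
     (\<forall>x y. \<sigma> (x + y) = \<sigma> x + \<sigma> y) \<and> (\<forall>x y. \<sigma> (x * y) = \<sigma> x * \<sigma> y)"

definition absolute_value :: "('k :: field \<Rightarrow> real) \<Rightarrow> bool" where
  "absolute_value v \<longleftrightarrow> (\<forall>x. v x \<ge> 0) \<and> (\<forall>x. v x = 0 \<longleftrightarrow> x = 0) \<and>
     (\<forall>x y. v (x * y) = v x * v y) \<and> (\<forall>x y. v (x + y) \<le> v x + v y)"

definition archimedean :: "('k :: field \<Rightarrow> real) \<Rightarrow> bool" where
  "archimedean v \<longleftrightarrow> absolute_value v \<and> \<not> (\<forall>x y. v (x + y) \<le> max (v x) (v y))"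

definition abs_equiv :: "(('k :: field \<Rightarrow> real) \<times> ('k \<Rightarrow> real)) set" where
  "abs_equiv = {(v, w). archimedean v \<and> archimedean w \<and> (\<exists>s>0. \<forall>x. w x = v x powr s)}"

definition archimedean_places :: "('k :: field \<Rightarrow> real) set set" where
  "archimedean_places = {v. archimedean v} // abs_equiv"

text \<open>
  The embedding corresponding to a place is only determined up to complex conjugation.
\<close>

definition embedding_at :: "('k :: field \<Rightarrow> real) set \<Rightarrow> ('k \<Rightarrow> complex) \<Rightarrow> bool" where
  "embedding_at \<nu> \<sigma> \<longleftrightarrow> field_embedding \<sigma> \<and> (\<lambda>x. cmod (\<sigma> x)) \<in> \<nu>"

lemma equiv_abs_equiv: "equiv {v :: 'k :: field \<Rightarrow> real. archimedean v} abs_equiv"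
proof (rule equivI)
  show "abs_equiv \<subseteq> {v :: 'k \<Rightarrow> real. archimedean v} \<times> {v. archimedean v}"
    by (auto simp: abs_equiv_def)
  show "refl_on {v :: 'k \<Rightarrow> real. archimedean v} abs_equiv"
    by (rule refl_onI)
      (auto simp: abs_equiv_def archimedean_def absolute_value_def intro!: exI[of _ 1])
  show "sym (abs_equiv :: (('k \<Rightarrow> real) \<times> _) set)"
  proof (rule symI)
    fix v w :: "'k \<Rightarrow> real" assume "(v, w) \<in> abs_equiv"
    then obtain s where s: "s > 0" "\<forall>x. w x = v x powr s" and vw: "archimedean v" "archimedean w"
      by (auto simp: abs_equiv_def)
    have "v x = w x powr (1 / s)" for x
      using s vw(1) by (simp add: powr_powr archimedean_def absolute_value_def)
    then show "(w, v) \<in> abs_equiv"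
      using s vw by (auto simp: abs_equiv_def intro!: exI[of _ "1 / s"])
  qed
  show "trans (abs_equiv :: (('k \<Rightarrow> real) \<times> _) set)"
    by (rule transI) (auto simp: abs_equiv_def powr_powr, metis mult_pos_pos)
qed

lemma field_embedding_archimedean:
  fixes \<sigma> :: "'k :: field_char_0 \<Rightarrow> complex"
  assumes "field_embedding \<sigma>"
  shows "archimedean (\<lambda>x. cmod (\<sigma> x))"
proof -
  have add: "\<sigma> (x + y) = \<sigma> x + \<sigma> y" and mult: "\<sigma> (x * y) = \<sigma> x * \<sigma> y" and one: "\<sigma> 1 = 1" for x y
    using assms by (auto simp: field_embedding_def)
  have zero: "\<sigma> 0 = 0"
    using add[of 0 0] by simp
  have "x = 0" if "\<sigma> x = 0" for x
    using mult[of x "inverse x"] that one by (cases "x = 0") auto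
  then have "absolute_value (\<lambda>x. cmod (\<sigma> x))"
    by (auto simp: absolute_value_def add mult zero norm_mult norm_triangle_ineq)
  moreover have "cmod (\<sigma> (1 + 1)) > max (cmod (\<sigma> 1)) (cmod (\<sigma> 1))"
    by (simp only: add one) simp
  ultimately show ?thesis
    unfolding archimedean_def by (metis not_le)
qed

lemma ex_archimedean_place:
  fixes \<sigma> :: "'k :: field_char_0 \<Rightarrow> complex"
  assumes "field_embedding \<sigma>"
  shows "\<exists>\<nu>\<in>archimedean_places. embedding_at \<nu> \<sigma>"
  using field_embedding_archimedean[OF assms] equiv_class_self[OF equiv_abs_equiv] assms
  unfolding archimedean_places_def embedding_at_def by (meson mem_Collect_eq quotientI)


text \<open>
  The iterates are regarded as maps into the Riemann sphere, so equicontinuity refers to the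
  chordal metric (with the Euclidean metric, points escaping to infinity would be excluded from
  the Fatou set). On the source the two metrics induce the same topology on the complex plane.
  The point at infinity lies in the Fatou set of every polynomial of degree at least 2, so for
  these the Julia set is a subset of the plane.
\<close>

definition chordal_dist :: "complex \<Rightarrow> complex \<Rightarrow> real" where
  "chordal_dist z w = 2 * cmod (z - w) / (sqrt (1 + (cmod z)\<^sup>2) * sqrt (1 + (cmod w)\<^sup>2))"

definition equicontinuous_at :: "complex \<Rightarrow> (complex \<Rightarrow> complex) set \<Rightarrow> bool" where
  "equicontinuous_at z F \<longleftrightarrow>
     (\<forall>\<epsilon>>0. \<exists>\<delta>>0. \<forall>f\<in>F. \<forall>w. dist w z < \<delta> \<longrightarrow> chordal_dist (f w) (f z) < \<epsilon>)"

definition fatou_set :: "(complex \<Rightarrow> complex) \<Rightarrow> complex set" where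
  "fatou_set f = \<Union>{U. open U \<and> (\<forall>z\<in>U. equicontinuous_at z (range (\<lambda>n. f ^^ n)))}"

definition julia_set :: "(complex \<Rightarrow> complex) \<Rightarrow> complex set" where
  "julia_set f = - fatou_set f"

end

theory Submission
  imports Defs "HOL-Library.Function_Algebras" "HOL-Number_Theory.Cong"
begin

text \<open>
  One complex embedding of the number field suffices. Let \<open>f\<close> be the image of the polynomial under
  it. The open unit disc is a connected part of the Fatou set that contains a point with bounded
  orbit, so its closure lies in the filled Julia set and all iterates of \<open>f\<close> are bounded by one
  constant on the unit circle. By Cauchy's inequality, the same constant bounds all coefficients of
  all iterates. But if \<open>a z\<^sup>j\<close> is the leading term of \<open>f - z\<^sup>d\<close>, then the \<open>n\<close>-th iterate is
  \<open>z\<^bsup>N\<^esup> + d\<^bsup>n-1\<^esup> a z\<^bsup>N-d+j\<^esup> + \<dots>\<close> with \<open>N = d\<^sup>n\<close>, so \<open>a = 0\<close>.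

  The embedding comes from the complex vector space of rational-linear maps from the field to the
  complex numbers: multiplications by field elements act on it as commuting operators, and the
  eigenvalues on a common eigenvector define a ring homomorphism.
\<close>

section \<open>Common eigenvectors of commuting operators\<close>

definition poly_op ::
    "('a :: zero \<Rightarrow> 'b :: ab_group_add \<Rightarrow> 'b) \<Rightarrow> ('b \<Rightarrow> 'b) \<Rightarrow> 'a poly \<Rightarrow> 'b \<Rightarrow> 'b" where
  "poly_op s T p v = fold_coeffs (\<lambda>a u. s a v + T u) p 0"

lemma poly_op_0 [simp]: "poly_op s T 0 v = 0"
  by (simp add: poly_op_def)

locale linear_operator = Vector_Spaces.linear s s T
  for s :: "'a :: field \<Rightarrow> 'b :: ab_group_add \<Rightarrow> 'b" and T :: "'b \<Rightarrow> 'b"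
begin

lemma poly_op_pCons: "poly_op s T (pCons a p) v = s a v + T (poly_op s T p v)"
  by (cases "a = 0 \<and> p = 0") (auto simp: poly_op_def)

lemma poly_op_add: "poly_op s T (p + q) v = poly_op s T p v + poly_op s T q v"
  by (induction p q rule: poly_induct2)
    (simp_all add: poly_op_pCons add vs1.scale_left_distrib add_ac)

lemma poly_op_smult: "poly_op s T (smult c p) v = s c (poly_op s T p v)"
  by (induction p) (simp_all add: poly_op_pCons scale vs1.scale_right_distrib)

lemma poly_op_linear_factor_mult:
  "poly_op s T ([:- r, 1:] * q) v = T (poly_op s T q v) - s r (poly_op s T q v)"
proof -
  have "[:- r, 1:] * q = smult (- r) q + pCons 0 q"
    by simp
  then show ?thesis
    by (simp only: poly_op_add poly_op_smult poly_op_pCons) simp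
qed

lemma poly_op_in_subspace:
  assumes "vs1.subspace W" and "T ` W \<subseteq> W" and "v \<in> W"
  shows "poly_op s T p v \<in> W"
  using assms
  by (induction p)
    (auto simp: poly_op_pCons intro!: vs1.subspace_add vs1.subspace_scale intro: vs1.subspace_0)

lemma subspace_eigenspace:
  assumes "vs1.subspace W"
  shows "vs1.subspace {w \<in> W. T w = s c w}"
  using assms
  by (intro vs1.subspaceI) (auto simp: zero add scale vs1.scale_right_distrib mult.commute
      intro: vs1.subspace_0 vs1.subspace_add vs1.subspace_scale)

end

locale alg_closed_vector_space = vector_space s
  for s :: "'a :: alg_closed_field \<Rightarrow> 'b :: ab_group_add \<Rightarrow> 'b"
begin

lemma eigenvector_in_invariant_subspace:
  assumes T: "linear_operator s T" and W: "subspace W" "T ` W \<subseteq> W"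
    and v: "v \<in> W" "v \<noteq> 0" and p: "p \<noteq> 0" "poly_op s T p v = 0"
  shows "\<exists>c. \<exists>u\<in>W. u \<noteq> 0 \<and> T u = s c u"
proof -
  interpret T: linear_operator s T
    by (rule T)
  show ?thesis
    using p
  proof (induction "degree p" arbitrary: p rule: less_induct)
    case less
    show ?case
    proof (cases "degree p = 0")
      case True
      then obtain a where "p = [:a:]"
        by (rule degree_eq_zeroE)
      then show ?thesis
        using less.prems v(2) by (simp add: T.poly_op_pCons)
    next
      case False
      then obtain r where "poly p r = 0"
        using alg_closed_imp_poly_has_root by blast
      then obtain q where q: "p = [:- r, 1:] * q"
        by (auto simp: poly_eq_0_iff_dvd elim: dvdE)
      with less.prems have "q \<noteq> 0"
        by auto
      have "degree q < degree p"
        using \<open>q \<noteq> 0\<close> unfolding q by (subst degree_mult_eq) auto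
      define u where "u = poly_op s T q v"
      have "T u = s r u"
        using less.prems(2) T.poly_op_linear_factor_mult[of r q v] by (simp add: q u_def)
      moreover have "u \<in> W"
        unfolding u_def using W v(1) by (rule T.poly_op_in_subspace)
      ultimately show ?thesis
        using less.hyps[OF \<open>degree q < degree p\<close> \<open>q \<noteq> 0\<close>] by (cases "u = 0") (auto simp: u_def)
    qed
  qed
qed

lemma common_eigenvector:
  assumes "finite F" and "subspace W" and "v \<in> W" and "v \<noteq> 0"
    and "\<And>T. T \<in> F \<Longrightarrow> linear_operator s T"
    and "\<And>T. T \<in> F \<Longrightarrow> T ` W \<subseteq> W"
    and "\<And>T w. T \<in> F \<Longrightarrow> w \<in> W \<Longrightarrow> \<exists>p. p \<noteq> 0 \<and> poly_op s T p w = 0"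
    and "\<And>S T w. S \<in> F \<Longrightarrow> T \<in> F \<Longrightarrow> S (T w) = T (S w)"
  shows "\<exists>u\<in>W. u \<noteq> 0 \<and> (\<forall>T\<in>F. \<exists>c. T u = s c u)"
  using assms
proof (induction F arbitrary: W v rule: finite_induct)
  case empty
  then show ?case
    by auto
next
  case (insert T F)
  note W = insert.prems(1) and v = insert.prems(2,3) and linear = insert.prems(4)
    and invariant = insert.prems(5) and annihilated = insert.prems(6) and commute = insert.prems(7)
  interpret T: linear_operator s T
    by (rule linear) simp
  obtain p where "p \<noteq> 0" "poly_op s T p v = 0"
    using v(1) annihilated by blast
  then obtain c u where u: "u \<in> W" "u \<noteq> 0" "T u = s c u"
    using eigenvector_in_invariant_subspace[OF T.linear_operator_axioms W invariant[OF insertI1] v]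
    by blast
  define E where "E = {w \<in> W. T w = s c w}"
  have "subspace E"
    using W unfolding E_def by (rule T.subspace_eigenspace)
  moreover have "S ` E \<subseteq> E" if "S \<in> F" for S
  proof -
    interpret S: linear_operator s S
      using that by (intro linear) simp
    have "T (S w) = s c (S w)" if "T w = s c w" for w
      using \<open>S \<in> F\<close> that commute[of T S w] by (simp add: S.scale)
    then show ?thesis
      using invariant[of S] that by (auto simp: E_def)
  qed
  moreover have "u \<in> E"
    using u by (simp add: E_def)
  ultimately obtain w where "w \<in> E" "w \<noteq> 0" "\<forall>S\<in>F. \<exists>c. S w = s c w"
    using insert.IH[of E u] linear annihilated commute u(2) by (auto simp: E_def)
  then show ?case
    by (auto simp: E_def)
qed

end

section \<open>Embeddings of number fields into algebraically closed fields\<close>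

lemma field_embedding_0: "field_embedding \<sigma> \<Longrightarrow> \<sigma> 0 = 0"
  unfolding field_embedding_def by (metis add_cancel_left_left)

lemma inj_field_embedding:
  assumes "field_embedding \<sigma>"
  shows "inj \<sigma>"
proof (rule injI)
  fix x y assume "\<sigma> x = \<sigma> y"
  then have "\<sigma> (x - y) = 0"
    using assms unfolding field_embedding_def by (metis add_cancel_left_left diff_add_cancel)
  then have "\<sigma> ((x - y) * inverse (x - y)) = 0"
    using assms by (simp add: field_embedding_def)
  then show "x = y"
    using assms by (cases "x = y") (simp_all add: field_embedding_def)
qed

lemma field_embedding_eq_0_iff:
  assumes "field_embedding \<sigma>"
  shows "\<sigma> x = 0 \<longleftrightarrow> x = 0"
  using inj_eq[OF inj_field_embedding[OF assms], of x 0] by (simp add: field_embedding_0[OF assms])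

lemma poly_map_poly_field_embedding:
  assumes "field_embedding \<sigma>"
  shows "poly (map_poly \<sigma> p) (\<sigma> x) = \<sigma> (poly p x)"
  using assms
  by (induction p) (simp_all add: map_poly_pCons field_embedding_0, simp add: field_embedding_def)

lemma map_poly_field_embedding_eq_monom_iff:
  assumes "field_embedding \<sigma>"
  shows "map_poly \<sigma> p = monom 1 n \<longleftrightarrow> p = monom 1 n"
proof -
  have "\<sigma> 1 = 1"
    using assms by (simp add: field_embedding_def)
  then have "\<sigma> x = 1 \<longleftrightarrow> x = 1" for x
    using inj_eq[OF inj_field_embedding[OF assms], of x 1] by simp
  then show ?thesis
    by (simp add: poly_eq_iff coeff_map_poly field_embedding_eq_0_iff[OF assms])
qed

lemma degree_map_poly_field_embedding:
  assumes "field_embedding \<sigma>"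
  shows "degree (map_poly \<sigma> p) = degree p"
  by (cases "p = 0") (auto intro!: degree_map_poly simp: field_embedding_eq_0_iff[OF assms])

lemma algebraic_of_rat_relation:
  fixes b :: "'a :: field_char_0"
  assumes "finite I" and "(\<Sum>i\<in>I. of_rat (c i) * b ^ i) = 0" and "i \<in> I" and "c i \<noteq> 0"
  shows "algebraic b"
proof (rule algebraicI')
  let ?p = "\<Sum>i\<in>I. monom (of_rat (c i)) i :: 'a poly"
  have coeff: "coeff ?p j = (if j \<in> I then of_rat (c j) else 0)" for j
    using assms(1) by (simp add: coeff_sum if_distrib cong: if_cong)
  show "coeff ?p j \<in> \<rat>" for j
    by (simp add: coeff)
  have "coeff ?p i \<noteq> 0"
    using assms(3,4) by (simp add: coeff)
  then show "?p \<noteq> 0"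
    by (metis coeff_0)
  show "poly ?p b = 0"
    using assms(2) by (simp add: poly_sum poly_monom)
qed

lemma number_field_imp_algebraic:
  fixes b :: "'k :: field_char_0"
  assumes "number_field TYPE('k)"
  shows "algebraic b"
proof -
  interpret V: vector_space "\<lambda>(q :: rat) (x :: 'k). of_rat q * x"
    by (rule vector_space_of_rat)
  obtain B :: "'k set" where B: "finite B" "V.span B = UNIV"
    using assms by (auto simp: number_field_def)
  show ?thesis
  proof (cases "inj (\<lambda>i::nat. b ^ i)")
    case True
    then have "V.dependent (range (\<lambda>i::nat. b ^ i))"
      using V.independent_span_bound[OF B(1)] B(2) range_inj_infinite by blast
    then obtain t u v where t: "finite t" "t \<subseteq> range (\<lambda>i. b ^ i)" "v \<in> t"
      and u: "(\<Sum>v\<in>t. of_rat (u v) * v) = 0" "u v \<noteq> 0"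
      unfolding V.dependent_explicit by blast
    obtain I where I: "finite I" "t = (\<lambda>i. b ^ i) ` I"
      using t(1,2) by (meson finite_subset_image)
    obtain i where i: "i \<in> I" "v = b ^ i"
      using t(3) I(2) by blast
    have "(\<Sum>i\<in>I. of_rat (u (b ^ i)) * b ^ i) = 0"
      using u(1) True unfolding I(2) by (simp add: sum.reindex inj_on_def)
    then show ?thesis
      using I(1) i u(2) algebraic_of_rat_relation[of I "\<lambda>i. u (b ^ i)" b i] by simp
  next
    case False
    then obtain i j where ij: "i \<noteq> j" "b ^ i = b ^ j"
      unfolding inj_def by blast
    then have "(\<Sum>k\<in>{i, j}. of_rat (if k = i then 1 else - 1) * b ^ k) = 0"
      by simp
    then show ?thesis
      using algebraic_of_rat_relation[of "{i, j}" "\<lambda>k. if k = i then 1 else - 1" b i] by simp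
  qed
qed

definition rat_linear :: "('k :: field_char_0 \<Rightarrow> 'c :: field_char_0) \<Rightarrow> bool" where
  "rat_linear \<eta> \<longleftrightarrow> (\<forall>x y. \<eta> (x + y) = \<eta> x + \<eta> y) \<and> (\<forall>q x. \<eta> (of_rat q * x) = of_rat q * \<eta> x)"

lemma rat_linear_of_int_mult: "rat_linear \<eta> \<Longrightarrow> \<eta> (of_int n * x) = of_int n * \<eta> x"
  unfolding rat_linear_def by (metis of_rat_of_int_eq)

lemma rat_linear_0: "rat_linear \<eta> \<Longrightarrow> \<eta> 0 = 0"
  using rat_linear_of_int_mult[of \<eta> 0] by simp

lemma ex_nonzero_rat_linear:
  "\<exists>\<eta> :: 'k :: field_char_0 \<Rightarrow> 'c :: field_char_0. rat_linear \<eta> \<and> \<eta> \<noteq> 0"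
proof -
  interpret vector_space_pair "\<lambda>(q :: rat) (x :: 'k). of_rat q * x"
    "\<lambda>(q :: rat) (x :: 'c). of_rat q * x"
    by (intro vector_space_pair.intro vector_space_of_rat)
  obtain \<eta> :: "'k \<Rightarrow> 'c"
    where "Vector_Spaces.linear (\<lambda>q x. of_rat q * x) (\<lambda>q x. of_rat q * x) \<eta>" "\<eta> 1 = 1"
    using linear_independent_extend[of "{1}" "\<lambda>_. 1"] by auto
  then have "rat_linear \<eta>" "\<eta> \<noteq> 0"
    by (auto simp: Vector_Spaces.linear_iff rat_linear_def)
  then show ?thesis
    by blast
qed

definition fun_scale :: "'c :: times \<Rightarrow> ('k \<Rightarrow> 'c) \<Rightarrow> 'k \<Rightarrow> 'c" where
  "fun_scale c \<eta> = (\<lambda>x. c * \<eta> x)"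

definition dual_mult :: "'k :: times \<Rightarrow> ('k \<Rightarrow> 'c) \<Rightarrow> 'k \<Rightarrow> 'c" where
  "dual_mult b \<eta> = (\<lambda>x. \<eta> (b * x))"

lemma linear_operator_dual_mult:
  "linear_operator (fun_scale :: 'c :: field \<Rightarrow> ('k :: times \<Rightarrow> 'c) \<Rightarrow> 'k \<Rightarrow> 'c) (dual_mult b)"
  by unfold_locales (auto simp: fun_scale_def dual_mult_def fun_eq_iff algebra_simps)

interpretation fun_space: alg_closed_vector_space
  "fun_scale :: 'c :: alg_closed_field \<Rightarrow> ('k \<Rightarrow> 'c) \<Rightarrow> 'k \<Rightarrow> 'c"
  by unfold_locales (auto simp: fun_scale_def fun_eq_iff algebra_simps)

lemma subspace_rat_linear:
  "fun_space.subspace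
    {\<eta> :: 'k :: field_char_0 \<Rightarrow> 'c :: {alg_closed_field, field_char_0}. rat_linear \<eta>}"
  by (rule fun_space.subspaceI)
    (simp_all add: rat_linear_def fun_scale_def distrib_left mult.left_commute)

lemma rat_linear_dual_mult: "rat_linear \<eta> \<Longrightarrow> rat_linear (dual_mult b \<eta>)"
  by (simp add: rat_linear_def dual_mult_def distrib_left mult.left_commute[of b])

lemma poly_op_dual_mult:
  assumes "rat_linear \<eta>"
  shows "poly_op fun_scale (dual_mult b) (map_poly of_int p) \<eta>
    = (\<lambda>x. \<eta> (poly (map_poly of_int p) b * x))"
proof (induction p)
  case 0
  then show ?case
    by (simp add: fun_eq_iff rat_linear_0[OF assms])
next
  case (pCons a p)
  have "(of_int a + b * y) * x = of_int a * x + y * (b * x)" for x y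
    by (simp add: algebra_simps)
  then have eval: "\<eta> ((of_int a + b * y) * x) = of_int a * \<eta> x + \<eta> (y * (b * x))" for x y
    using assms rat_linear_of_int_mult[OF assms] by (simp add: rat_linear_def)
  have "poly_op fun_scale (dual_mult b) (map_poly of_int (pCons a p)) \<eta>
      = fun_scale (of_int a) \<eta> + dual_mult b (\<lambda>x. \<eta> (poly (map_poly of_int p) b * x))"
    by (simp add: map_poly_pCons linear_operator.poly_op_pCons[OF linear_operator_dual_mult] pCons.IH)
  also have "\<dots> = (\<lambda>x. \<eta> (poly (map_poly of_int (pCons a p)) b * x))"
    by (simp add: map_poly_pCons fun_scale_def dual_mult_def fun_eq_iff eval)
  finally show ?case .
qed

lemma dual_mult_annihilated:
  fixes \<eta> :: "'k :: field_char_0 \<Rightarrow> 'c :: field_char_0"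
  assumes "algebraic b" and "rat_linear \<eta>"
  shows "\<exists>p. p \<noteq> 0 \<and> poly_op fun_scale (dual_mult b) p \<eta> = 0"
proof -
  obtain p where p: "p \<noteq> 0" "poly (map_poly of_int p) b = 0"
    using assms(1) by (rule algebraicE')
  have "poly_op fun_scale (dual_mult b) (map_poly of_int p) \<eta> = 0"
    by (simp add: poly_op_dual_mult[OF assms(2)] p(2) rat_linear_0[OF assms(2)] fun_eq_iff)
  moreover have "map_poly of_int p \<noteq> (0 :: 'c poly)"
    using p(1) by (simp add: map_poly_eq_0_iff)
  ultimately show ?thesis
    by blast
qed

lemma ex_common_dual_eigenvector:
  fixes B :: "'k :: field_char_0 set"
  assumes "finite B" and "\<And>b. b \<in> B \<Longrightarrow> algebraic b"
  shows "\<exists>\<eta> :: 'k \<Rightarrow> 'c :: {alg_closed_field, field_char_0}.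
    rat_linear \<eta> \<and> \<eta> \<noteq> 0 \<and> (\<forall>b\<in>B. \<exists>c. dual_mult b \<eta> = fun_scale c \<eta>)"
proof -
  obtain \<eta>\<^sub>0 :: "'k \<Rightarrow> 'c" where \<eta>\<^sub>0: "rat_linear \<eta>\<^sub>0" "\<eta>\<^sub>0 \<noteq> 0"
    using ex_nonzero_rat_linear by blast
  have "\<exists>\<eta>\<in>{\<eta> :: 'k \<Rightarrow> 'c. rat_linear \<eta>}. \<eta> \<noteq> 0 \<and> (\<forall>T\<in>dual_mult ` B. \<exists>c. T \<eta> = fun_scale c \<eta>)"
  proof (rule fun_space.common_eigenvector)
    show "finite (dual_mult ` B)"
      using \<open>finite B\<close> by simp
    show "fun_space.subspace {\<eta> :: 'k \<Rightarrow> 'c. rat_linear \<eta>}"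
      by (rule subspace_rat_linear)
    show "\<eta>\<^sub>0 \<in> {\<eta>. rat_linear \<eta>}" "\<eta>\<^sub>0 \<noteq> 0"
      using \<eta>\<^sub>0 by simp_all
  next
    fix T :: "('k \<Rightarrow> 'c) \<Rightarrow> 'k \<Rightarrow> 'c" assume "T \<in> dual_mult ` B"
    then obtain b where "b \<in> B" and T: "T = dual_mult b"
      by blast
    show "linear_operator fun_scale T"
      unfolding T by (rule linear_operator_dual_mult)
    show "T ` {\<eta>. rat_linear \<eta>} \<subseteq> {\<eta>. rat_linear \<eta>}"
      using rat_linear_dual_mult by (auto simp: T)
    show "\<exists>p. p \<noteq> 0 \<and> poly_op fun_scale T p \<eta> = 0" if "\<eta> \<in> {\<eta>. rat_linear \<eta>}" for \<eta>
      using dual_mult_annihilated[OF assms(2)[OF \<open>b \<in> B\<close>]] that by (simp add: T)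
    show "S (T \<eta>) = T (S \<eta>)" if "S \<in> dual_mult ` B" for S \<eta>
      using that by (auto simp: T dual_mult_def mult.left_commute)
  qed
  then show ?thesis
    by auto
qed

lemma subspace_dual_mult_scalar:
  assumes "rat_linear \<eta>"
  shows "module.subspace (\<lambda>q x. of_rat q * x) {a. \<exists>c. dual_mult a \<eta> = fun_scale c \<eta>}"
    (is "module.subspace _ ?E")
proof -
  interpret vector_space "\<lambda>q (x :: 'a). of_rat q * x"
    by (rule vector_space_of_rat)
  show ?thesis
  proof (rule subspaceI)
    show "0 \<in> ?E"
      by (auto simp: dual_mult_def fun_scale_def rat_linear_0[OF assms] intro!: exI[of _ 0])
  next
    fix a b assume "a \<in> ?E" and "b \<in> ?E"
    then obtain c d where "\<And>x. \<eta> (a * x) = c * \<eta> x" "\<And>x. \<eta> (b * x) = d * \<eta> x"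
      by (auto simp: dual_mult_def fun_scale_def fun_eq_iff)
    then have "dual_mult (a + b) \<eta> = fun_scale (c + d) \<eta>"
      using assms by (simp add: rat_linear_def dual_mult_def fun_scale_def distrib_right)
    then show "a + b \<in> ?E"
      by blast
  next
    fix q a assume "a \<in> ?E"
    then obtain c where "\<And>x. \<eta> (a * x) = c * \<eta> x"
      by (auto simp: dual_mult_def fun_scale_def fun_eq_iff)
    then have "dual_mult (of_rat q * a) \<eta> = fun_scale (of_rat q * c) \<eta>"
      using assms by (simp add: rat_linear_def dual_mult_def fun_scale_def mult.assoc)
    then show "of_rat q * a \<in> ?E"
      by blast
  qed
qed

lemma field_embedding_of_dual_eigenvector:
  fixes \<eta> :: "'k :: field_char_0 \<Rightarrow> 'c :: field_char_0"
  assumes "rat_linear \<eta>" and "\<eta> \<noteq> 0" and "\<And>a. dual_mult a \<eta> = fun_scale (\<sigma> a) \<eta>"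
  shows "field_embedding \<sigma>"
proof -
  obtain x where x: "\<eta> x \<noteq> 0"
    using assms(2) by (auto simp: fun_eq_iff)
  have \<sigma>: "\<sigma> a * \<eta> y = \<eta> (a * y)" for a y
    using assms(3)[of a] by (simp add: dual_mult_def fun_scale_def fun_eq_iff)
  have "\<sigma> 1 * \<eta> x = 1 * \<eta> x"
    by (simp add: \<sigma>)
  moreover have "\<sigma> (a + b) * \<eta> x = (\<sigma> a + \<sigma> b) * \<eta> x" for a b
    using assms(1) by (simp add: \<sigma> rat_linear_def distrib_right)
  moreover have "\<sigma> (a * b) * \<eta> x = (\<sigma> a * \<sigma> b) * \<eta> x" for a b
    by (simp add: \<sigma> mult.assoc)
  ultimately show ?thesis
    using x by (simp add: field_embedding_def)
qed

theorem number_field_embedding_exists: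
  assumes "number_field TYPE('k :: field_char_0)"
  shows "\<exists>\<sigma> :: 'k \<Rightarrow> 'c :: {alg_closed_field, field_char_0}. field_embedding \<sigma>"
proof -
  interpret V: vector_space "\<lambda>(q :: rat) (x :: 'k). of_rat q * x"
    by (rule vector_space_of_rat)
  obtain B :: "'k set" where B: "finite B" "V.span B = UNIV"
    using assms by (auto simp: number_field_def)
  obtain \<eta> :: "'k \<Rightarrow> 'c"
    where \<eta>: "rat_linear \<eta>" "\<eta> \<noteq> 0" "\<forall>b\<in>B. \<exists>c. dual_mult b \<eta> = fun_scale c \<eta>"
    using ex_common_dual_eigenvector[OF B(1) number_field_imp_algebraic[OF assms]] by blast
  have "\<exists>c. dual_mult a \<eta> = fun_scale c \<eta>" for a
    using B(2) \<eta>(3) V.span_induct[OF _ subspace_dual_mult_scalar[OF \<eta>(1)], of a B] by auto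
  then obtain \<sigma> where "\<And>a. dual_mult a \<eta> = fun_scale (\<sigma> a) \<eta>"
    by metis
  then show ?thesis
    using field_embedding_of_dual_eigenvector[OF \<eta>(1,2)] by blast
qed

section \<open>The filled Julia set\<close>

definition escape_radius :: "('a :: real_normed_vector \<Rightarrow> 'a) \<Rightarrow> real \<Rightarrow> bool" where
  "escape_radius f R \<longleftrightarrow> R > 0 \<and> (\<forall>z. R \<le> norm z \<longrightarrow> 2 * norm z \<le> norm (f z))"

definition filled_julia_set :: "('a :: metric_space \<Rightarrow> 'a) \<Rightarrow> 'a set" where
  "filled_julia_set f = {z. bounded (range (\<lambda>n. (f ^^ n) z))}"

lemma ex_escape_radius_poly:
  fixes f :: "'a :: real_normed_field poly"
  assumes "degree f \<ge> 2"
  shows "\<exists>R. escape_radius (poly f) R"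
proof -
  obtain a b p where f: "f = pCons a (pCons b p)"
    by (metis pCons_cases)
  with assms have "p \<noteq> 0"
    by (auto split: if_splits)
  then obtain r where r: "\<And>z. r \<le> norm z \<Longrightarrow> 3 \<le> norm (poly (pCons b p) z)"
    using poly_infinity by blast
  have "2 * norm z \<le> norm (poly f z)" if z: "max 1 (max r (norm a)) \<le> norm z" for z
  proof -
    have "3 * norm z \<le> norm (poly (pCons b p) z) * norm z"
      using r z by (intro mult_right_mono) auto
    also have "\<dots> = norm (poly f z - a)"
      by (simp add: f norm_mult)
    also have "\<dots> \<le> norm (poly f z) + norm a"
      by (rule norm_triangle_ineq4)
    finally show ?thesis
      using z by simp
  qed
  then show ?thesis
    unfolding escape_radius_def by (intro exI[of _ "max 1 (max r (norm a))"]) simp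
qed

lemma escape_radius_funpow:
  assumes "escape_radius f R" and "R \<le> norm z"
  shows "2 ^ n * R \<le> norm ((f ^^ n) z)"
proof (induction n)
  case 0
  then show ?case
    using assms(2) by simp
next
  case (Suc n)
  have "R \<le> 2 ^ n * R"
    using assms(1) by (simp add: escape_radius_def)
  with Suc have "R \<le> norm ((f ^^ n) z)"
    by linarith
  then have "2 * norm ((f ^^ n) z) \<le> norm ((f ^^ Suc n) z)"
    using assms(1) by (simp add: escape_radius_def)
  then show ?case
    using Suc by simp
qed

lemma filled_julia_set_eq:
  assumes "escape_radius f R"
  shows "filled_julia_set f = {z. \<forall>n. norm ((f ^^ n) z) \<le> R}"
proof (intro equalityI subsetI)
  fix z assume "z \<in> filled_julia_set f"
  then obtain M where M: "\<And>n. norm ((f ^^ n) z) \<le> M"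
    by (auto simp: filled_julia_set_def bounded_iff)
  have "norm ((f ^^ n) z) \<le> R" for n
  proof (rule ccontr)
    assume "\<not> norm ((f ^^ n) z) \<le> R"
    then have "2 ^ k * R \<le> norm ((f ^^ (k + n)) z)" for k
      using escape_radius_funpow[OF assms, of "(f ^^ n) z" k] by (simp add: funpow_add)
    then have "2 ^ k * R \<le> M" for k
      using M order_trans by blast
    moreover obtain k where "M / R < 2 ^ k"
      using real_arch_pow[of 2 "M / R"] by auto
    ultimately show False
      using assms by (simp add: escape_radius_def divide_less_eq not_le flip: not_less)
  qed
  then show "z \<in> {z. \<forall>n. norm ((f ^^ n) z) \<le> R}"
    by simp
qed (auto simp: filled_julia_set_def bounded_iff)

lemma closed_filled_julia_set:
  assumes "escape_radius f R" and "continuous_on UNIV f"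
  shows "closed (filled_julia_set f)"
proof -
  have "continuous_on UNIV (f ^^ n)" for n
    by (induction n) (simp_all add: continuous_on_compose2[OF assms(2)] comp_def)
  then show ?thesis
    unfolding filled_julia_set_eq[OF assms(1)] Collect_all_eq
    by (intro closed_INT ballI closed_Collect_le continuous_intros)
qed

lemma norm_less_of_chordal_dist_less:
  assumes "R \<ge> 0" and "cmod v \<le> R" and "chordal_dist u v < 1 / (1 + R)"
  shows "cmod u < 1 + 2 * R"
proof -
  have sqrt_le: "sqrt (1 + x\<^sup>2) \<le> 1 + x" if "x \<ge> 0" for x :: real
    using that by (intro real_le_lsqrt) (auto simp: power2_eq_square algebra_simps)
  have "sqrt (1 + (cmod u)\<^sup>2) * sqrt (1 + (cmod v)\<^sup>2) > 0"
    by (intro mult_pos_pos) (auto simp: add_pos_nonneg)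
  then have "2 * cmod (u - v) < 1 / (1 + R) * (sqrt (1 + (cmod u)\<^sup>2) * sqrt (1 + (cmod v)\<^sup>2))"
    using assms(3) unfolding chordal_dist_def by (simp only: pos_divide_less_eq)
  also have "\<dots> \<le> 1 / (1 + R) * ((1 + cmod u) * (1 + R))"
    using sqrt_le[of "cmod u"] sqrt_le[of "cmod v"] assms(1,2)
    by (intro mult_left_mono mult_mono) auto
  also have "\<dots> = 1 + cmod u"
    using assms(1) by simp
  finally show ?thesis
    using norm_triangle_ineq2[of u v] assms(2) by linarith
qed

lemma fatou_set_equicontinuous_at:
  "z \<in> fatou_set f \<Longrightarrow> equicontinuous_at z (range (\<lambda>n. f ^^ n))"
  by (auto simp: fatou_set_def)

lemma open_fatou_set: "open (fatou_set f)"
  by (auto simp: fatou_set_def)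

lemma open_fatou_set_Int_filled_julia_set:
  assumes "escape_radius f R"
  shows "open (fatou_set f \<inter> filled_julia_set f)"
proof -
  have "\<exists>\<delta>>0. ball z \<delta> \<subseteq> filled_julia_set f" if "z \<in> fatou_set f" "z \<in> filled_julia_set f" for z
  proof -
    have R: "R > 0" and orbit: "\<And>n. cmod ((f ^^ n) z) \<le> R"
      using assms that(2) filled_julia_set_eq[OF assms] by (auto simp: escape_radius_def)
    obtain \<delta> where "\<delta> > 0"
      and \<delta>: "\<And>n w. dist w z < \<delta> \<Longrightarrow> chordal_dist ((f ^^ n) w) ((f ^^ n) z) < 1 / (1 + R)"
      using fatou_set_equicontinuous_at[OF \<open>z \<in> fatou_set f\<close>] R unfolding equicontinuous_at_def
      by (auto dest!: spec[of _ "1 / (1 + R)"])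
    have "cmod ((f ^^ n) w) \<le> 1 + 2 * R" if "w \<in> ball z \<delta>" for n w
      using norm_less_of_chordal_dist_less[OF _ orbit \<delta>] R that
      by (auto simp: dist_commute less_imp_le)
    then have "bounded (range (\<lambda>n. (f ^^ n) w))" if "w \<in> ball z \<delta>" for w
      using that by (intro boundedI) auto
    then have "ball z \<delta> \<subseteq> filled_julia_set f"
      by (auto simp: filled_julia_set_def)
    with \<open>\<delta> > 0\<close> show ?thesis
      by blast
  qed
  then have "fatou_set f \<inter> filled_julia_set f = fatou_set f \<inter> interior (filled_julia_set f)"
    using interior_subset by (auto simp: mem_interior)
  then show ?thesis
    by (simp add: open_Int open_fatou_set)
qed

lemma connected_subset_filled_julia_set:
  assumes f: "escape_radius f R" "continuous_on UNIV f"
    and U: "connected U" "julia_set f \<inter> U = {}" "U \<inter> filled_julia_set f \<noteq> {}"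
  shows "U \<subseteq> filled_julia_set f"
proof -
  have "U \<subseteq> fatou_set f"
    using U(2) by (auto simp: julia_set_def)
  then have "U \<inter> filled_julia_set f = U \<inter> (fatou_set f \<inter> filled_julia_set f)"
    by blast
  then have "openin (top_of_set U) (U \<inter> filled_julia_set f)"
    using open_fatou_set_Int_filled_julia_set[OF f(1)] by (simp add: openin_open_Int)
  moreover have "closedin (top_of_set U) (U \<inter> filled_julia_set f)"
    using closed_filled_julia_set[OF f] by (rule closedin_closed_Int)
  ultimately show ?thesis
    using U(1,3) connected_clopen by blast
qed

lemma preperiodic_imp_finite_orbit:
  assumes "preperiodic f z"
  shows "finite (range (\<lambda>n. (f ^^ n) z))"
proof -
  obtain n m where nm: "m < n" "(f ^^ n) z = (f ^^ m) z"
    using assms by (auto simp: preperiodic_def)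
  have "\<exists>i<n. (f ^^ k) z = (f ^^ i) z" for k
  proof (induction k)
    case 0
    then show ?case
      using nm(1) by (intro exI[of _ 0]) auto
  next
    case (Suc k)
    then obtain i where "i < n" "(f ^^ Suc k) z = (f ^^ Suc i) z"
      by auto
    then have "(f ^^ Suc k) z = (f ^^ (if Suc i = n then m else Suc i)) z"
      using nm(2) by (simp del: funpow.simps)
    then show ?case
      using nm(1) \<open>i < n\<close> by (intro exI[of _ "if Suc i = n then m else Suc i"]) simp
  qed
  then have "range (\<lambda>n. (f ^^ n) z) \<subseteq> (\<lambda>i. (f ^^ i) z) ` {..<n}"
    by blast
  then show ?thesis
    by (rule finite_subset) simp
qed

lemma preperiodic_in_filled_julia_set: "preperiodic f z \<Longrightarrow> z \<in> filled_julia_set f"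
  by (simp add: filled_julia_set_def finite_imp_bounded preperiodic_imp_finite_orbit)

lemma preperiodic_semiconj:
  assumes "preperiodic f z" and "\<And>x. h (f x) = g (h x)"
  shows "preperiodic g (h z)"
proof -
  have "h ((f ^^ n) z) = (g ^^ n) (h z)" for n
    by (induction n) (simp_all add: assms(2))
  then show ?thesis
    using assms(1) unfolding preperiodic_def by metis
qed

section \<open>Coefficients of the iterates of a polynomial\<close>

lemma Cauchy_coeff_bound:
  fixes p :: "complex poly"
  assumes "r > 0" and "\<And>z. cmod z = r \<Longrightarrow> cmod (poly p z) \<le> B"
  shows "cmod (coeff p n) \<le> B / r ^ n"
proof -
  have "eval_fps (fps_of_poly p) = poly p"
    by (simp add: fun_eq_iff)
  then have "coeff p n = (deriv ^^ n) (poly p) 0 / fact n"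
    using fps_nth_conv_deriv[of "fps_of_poly p" n] by simp
  moreover have "cmod ((deriv ^^ n) (poly p) 0) \<le> fact n * B / r ^ n"
    using assms by (intro Cauchy_inequality) (auto intro!: continuous_intros holomorphic_intros)
  ultimately show ?thesis
    by (simp add: norm_divide divide_le_eq mult.commute)
qed

text \<open>
  Reflection turns the coefficients just below the leading one into low-order coefficients, so
  that the leading behaviour of powers can be computed modulo a power of the variable.
\<close>

lemma cong_one_plus_monom_power:
  fixes r :: "'a :: field poly"
  assumes "m > 0" and "[r = 1 + monom c m] (mod monom 1 (Suc m))"
  shows "[r ^ k = 1 + monom (of_nat k * c) m] (mod monom 1 (Suc m))"
proof (induction k)
  case 0
  then show ?case
    by simp
next
  case (Suc k)
  have "(1 + monom c m) * (1 + monom (of_nat k * c) m) - (1 + monom (of_nat (Suc k) * c) m)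
      = monom (of_nat k * c * c) (m + m)"
    by (simp add: algebra_simps mult_monom flip: add_monom)
  also have "monom 1 (Suc m) dvd \<dots>"
    using assms(1) by (simp add: monom_1_dvd_iff')
  finally have "[(1 + monom c m) * (1 + monom (of_nat k * c) m) = 1 + monom (of_nat (Suc k) * c) m]
      (mod monom 1 (Suc m))"
    by (simp add: cong_iff_dvd_diff)
  with cong_mult[OF assms(2) Suc] show ?case
    by (simp only: power_Suc) (rule cong_trans)
qed

lemma reflect_poly_add_lower_cong:
  fixes p q :: "'a :: field poly"
  assumes "degree q + m < degree p"
  shows "[reflect_poly (p + q) = reflect_poly p] (mod monom 1 (Suc m))"
proof -
  have "degree (p + q) = degree p"
    using assms by (intro degree_add_eq_left) simp
  then show ?thesis
    using assms by (auto simp: cong_iff_dvd_diff monom_1_dvd_iff' coeff_reflect_poly coeff_eq_0)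
qed

definition iterate_poly :: "'a :: comm_semiring_1 poly \<Rightarrow> nat \<Rightarrow> 'a poly" where
  "iterate_poly f n = (pcompose f ^^ n) [:0, 1:]"

lemma poly_iterate_poly: "poly (iterate_poly f n) = poly f ^^ n"
  by (induction n) (simp_all add: iterate_poly_def poly_pcompose fun_eq_iff)

lemma degree_iterate_poly:
  fixes f :: "'a :: {comm_semiring_1, semiring_no_zero_divisors} poly"
  shows "degree (iterate_poly f n) = degree f ^ n"
  by (induction n) (simp_all add: iterate_poly_def degree_pcompose)

lemma degree_le_degree_iterate_poly_Suc:
  fixes f :: "'a :: {comm_semiring_1, semiring_no_zero_divisors} poly"
  shows "degree f \<le> degree (iterate_poly f (Suc n))"
  unfolding degree_iterate_poly by (cases "degree f = 0") (auto intro!: self_le_power)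

lemma pcompose_monom:
  fixes p :: "'a :: comm_semiring_1 poly"
  shows "pcompose (monom a n) p = smult a (p ^ n)"
  by (induction n) (simp_all add: monom_0 monom_Suc pcompose_pCons)

lemma degree_monom_add:
  fixes g :: "'a :: comm_semiring_1 poly"
  shows "degree g < d \<Longrightarrow> degree (monom 1 d + g) = d"
  by (simp add: degree_add_eq_left degree_monom_eq)

lemma reflect_poly_monom_add_cong:
  fixes g :: "'a :: field poly"
  assumes "degree g < d"
  shows "[reflect_poly (monom 1 d + g) = 1 + monom (lead_coeff g) (d - degree g)]
    (mod monom 1 (Suc (d - degree g)))"
  using assms
  by (auto simp: cong_iff_dvd_diff monom_1_dvd_iff' coeff_reflect_poly degree_monom_add coeff_eq_0)

lemma degree_pcompose_add_less:
  fixes g p :: "'a :: field poly"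
  assumes "degree g < d" and "degree p \<ge> 2"
  shows "degree (pcompose g p) + (d - degree g) < degree (p ^ d)"
proof -
  have "d - degree g < (d - degree g) * degree p"
    using assms by simp
  then have "degree g * degree p + (d - degree g) < (degree g + (d - degree g)) * degree p"
    by (simp only: add_mult_distrib add_less_cancel_left)
  moreover have "p \<noteq> 0"
    using assms(2) by auto
  ultimately show ?thesis
    using assms(1) by (simp add: degree_pcompose degree_power_eq)
qed

lemma reflect_poly_iterate_poly_cong:
  fixes g :: "'a :: field poly"
  assumes "degree g < d" and "d \<ge> 2"
  defines "f \<equiv> monom 1 d + g" and "m \<equiv> d - degree g"
  shows "[reflect_poly (iterate_poly f (Suc n)) = 1 + monom (of_nat d ^ n * lead_coeff g) m]
    (mod monom 1 (Suc m))"
proof (induction n)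
  case 0
  then show ?case
    using reflect_poly_monom_add_cong[OF assms(1)] by (simp add: iterate_poly_def f_def m_def)
next
  case (Suc n)
  define p where "p = iterate_poly f (Suc n)"
  have "degree f = d"
    unfolding f_def using assms(1) by (rule degree_monom_add)
  then have deg_p: "degree p \<ge> 2"
    using degree_le_degree_iterate_poly_Suc[of f n] assms(2) by (simp add: p_def)
  have "degree (pcompose g p) + m < degree (p ^ d)"
    unfolding m_def using assms(1) deg_p by (rule degree_pcompose_add_less)
  then have "[reflect_poly (pcompose f p) = reflect_poly p ^ d] (mod monom 1 (Suc m))"
    using reflect_poly_add_lower_cong[of "pcompose g p" m "p ^ d"]
    by (simp add: f_def pcompose_add pcompose_monom reflect_poly_power)
  also have "[reflect_poly p ^ d = 1 + monom (of_nat d * (of_nat d ^ n * lead_coeff g)) m]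
      (mod monom 1 (Suc m))"
    using assms(1) Suc unfolding p_def by (intro cong_one_plus_monom_power) (simp_all add: m_def)
  finally show ?case
    by (simp add: p_def iterate_poly_def mult.assoc)
qed

lemma coeff_iterate_poly:
  fixes g :: "'a :: field poly"
  assumes "degree g < d" and "d \<ge> 2"
  shows "coeff (iterate_poly (monom 1 d + g) (Suc n)) (d ^ Suc n - (d - degree g))
    = of_nat d ^ n * lead_coeff g"
proof -
  define f m p where "f = monom 1 d + g" and "m = d - degree g" and "p = iterate_poly f (Suc n)"
  have "degree f = d"
    unfolding f_def using assms(1) by (rule degree_monom_add)
  then have deg_p: "degree p = d ^ Suc n"
    by (simp only: p_def degree_iterate_poly)
  have "m \<le> degree p"
    using degree_le_degree_iterate_poly_Suc[of f n] \<open>degree f = d\<close> unfolding p_def m_def by linarith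
  with deg_p have "coeff p (d ^ Suc n - m) = coeff (reflect_poly p) m"
    by (simp add: coeff_reflect_poly)
  also have "\<dots> = coeff (1 + monom (of_nat d ^ n * lead_coeff g) m) m"
    using reflect_poly_iterate_poly_cong[OF assms, of n]
    unfolding cong_iff_dvd_diff monom_1_dvd_iff' by (simp add: f_def m_def p_def)
  also have "\<dots> = of_nat d ^ n * lead_coeff g"
    using assms(1) by (simp add: m_def)
  finally show ?thesis
    by (simp only: p_def f_def m_def)
qed

lemma bounded_iterates_imp_lower_terms_eq_0:
  fixes g :: "complex poly"
  assumes "degree g < d" and "d \<ge> 2"
    and bounded: "\<And>n z. cmod z = 1 \<Longrightarrow> cmod ((poly (monom 1 d + g) ^^ n) z) \<le> B"
  shows "g = 0"
proof (rule ccontr)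
  assume "g \<noteq> 0"
  define f where "f = monom 1 d + g"
  have "real d ^ n * cmod (lead_coeff g) \<le> B" for n
  proof -
    have "cmod (coeff (iterate_poly f (Suc n)) k) \<le> B / 1 ^ k" for k
    proof (rule Cauchy_coeff_bound)
      show "cmod (poly (iterate_poly f (Suc n)) z) \<le> B" if "cmod z = 1" for z
        using bounded[OF that] by (simp only: poly_iterate_poly f_def)
    qed simp
    then have "cmod (of_nat d ^ n * lead_coeff g) \<le> B"
      unfolding f_def using coeff_iterate_poly[OF assms(1,2)] by (metis div_by_1 power_one)
    then show ?thesis
      by (simp add: norm_mult norm_power)
  qed
  moreover obtain n where "B / cmod (lead_coeff g) < real d ^ n"
    using real_arch_pow[of "real d" "B / cmod (lead_coeff g)"] assms(2) by auto
  ultimately show False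
    using \<open>g \<noteq> 0\<close> by (simp add: divide_less_eq not_le flip: not_less)
qed

lemma degree_diff_monom_less:
  fixes f :: "'a :: comm_ring_1 poly"
  assumes "lead_coeff f = 1" and "degree f > 0"
  shows "degree (f - monom 1 (degree f)) < degree f"
proof (rule degree_lessI)
  show "\<forall>k\<ge>degree f. coeff (f - monom 1 (degree f)) k = 0"
    using assms(1) by (auto simp: le_less coeff_eq_0)
qed (use assms(2) in simp)

lemma monic_poly_eq_monom_if_julia_set_avoids_disc:
  fixes f :: "complex poly"
  assumes deg: "degree f \<ge> 2" and lead: "lead_coeff f = 1"
    and julia: "julia_set (poly f) \<inter> ball 0 1 = {}"
    and filled: "ball 0 1 \<inter> filled_julia_set (poly f) \<noteq> {}"
  shows "f = monom 1 (degree f)"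
proof -
  obtain R where R: "escape_radius (poly f) R"
    using ex_escape_radius_poly[OF deg] by blast
  have cont: "continuous_on UNIV (poly f)"
    by (intro continuous_intros)
  have "ball 0 1 \<subseteq> filled_julia_set (poly f)"
    using connected_subset_filled_julia_set[OF R cont connected_ball julia filled] .
  then have "closure (ball 0 1) \<subseteq> filled_julia_set (poly f)"
    using closed_filled_julia_set[OF R cont] by (rule closure_minimal)
  then have "z \<in> filled_julia_set (poly f)" if "cmod z = 1" for z
    by (rule subsetD) (use that in simp)
  then have "cmod ((poly f ^^ n) z) \<le> R" if "cmod z = 1" for n z
    using that by (simp add: filled_julia_set_eq[OF R])
  moreover have "degree (f - monom 1 (degree f)) < degree f"
    using deg lead by (intro degree_diff_monom_less) auto
  ultimately have "f - monom 1 (degree f) = 0"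
    using deg by (intro bounded_iterates_imp_lower_terms_eq_0[of _ "degree f" R]) simp_all
  then show ?thesis
    by simp
qed

theorem theorem1p5:
  fixes \<phi> :: "'k :: field_char_0 poly" and d :: nat
  assumes "number_field TYPE('k)"
    and "degree \<phi> = d" and "d \<ge> 2" and "lead_coeff \<phi> = 1"
    and "\<forall>i. coeff \<phi> i \<in> ring_of_integers"
    and "preperiodic (poly \<phi>) 0"
    and "\<forall>\<nu>\<in>archimedean_places. \<forall>\<sigma>. embedding_at \<nu> \<sigma> \<longrightarrow>
           julia_set (poly (map_poly \<sigma> \<phi>)) \<inter> {z. cmod z < 1} = {}"
  shows "\<phi> = monom 1 d"
proof -
  obtain \<sigma> :: "'k \<Rightarrow> complex" where \<sigma>: "field_embedding \<sigma>"
    using number_field_embedding_exists[OF assms(1)] by blast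
  define f where "f = map_poly \<sigma> \<phi>"
  have deg: "degree f = d"
    using assms(2) by (simp add: f_def degree_map_poly_field_embedding[OF \<sigma>])
  have lead: "lead_coeff f = 1"
    using assms(2,4) \<sigma> deg
    by (simp add: f_def coeff_map_poly field_embedding_0 field_embedding_def)
  have "preperiodic (poly f) (\<sigma> 0)"
    using assms(6) by (rule preperiodic_semiconj)
      (simp add: f_def poly_map_poly_field_embedding[OF \<sigma>])
  then have "0 \<in> ball 0 1 \<inter> filled_julia_set (poly f)"
    using preperiodic_in_filled_julia_set by (simp add: field_embedding_0[OF \<sigma>])
  moreover have "julia_set (poly f) \<inter> ball 0 1 = {}"
    using ex_archimedean_place[OF \<sigma>] assms(7) by (auto simp: f_def ball_def)
  ultimately have "f = monom 1 d"
    using monic_poly_eq_monom_if_julia_set_avoids_disc[of f] deg lead assms(3) by blast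
  then show ?thesis
    using map_poly_field_embedding_eq_monom_iff[OF \<sigma>] by (simp add: f_def)
qed

end
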